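(* Let $M$ be a regular singular difference module over $K$. Write $M=K\otimes_{\mathbb C}V$, where $V$ is a finite-dimensional $\mathbb C$-vector space with $A\in \mathrm{GL}(V)$ all of whose eigenvalues $\alpha$ satisfy $|q|<|\alpha|\le 1$, and $\Phi(a\otimes v)=\phi(a)\otimes A(v)$ for $a\in K$, $v\in V$ (such a presentation exists). Let $M_{global}\subset M$ be the set of $m\in M$ such that the $\mathbb C$-vector space spanned by $\{\Phi^n m\mid n\ge 0\}$ is finite-dimensional. Then $M_{global}=\mathbb C[z,z^{-1}]\otimes_{\mathbb C}V$, and consequently the natural map $K\otimes_{\mathbb C[z,z^{-1}]}M_{global}\to M$ is an isomorphism.
   Context: Fix $q\in\mathbb C$ with $0<|q|<1$. A difference ring is a commutative ring $R$ with an automorphism $\phi$; a difference module over $R$ is a free $R$-module $M$ of finite rank with an additive bijection $\Phi:M\to M$ satisfying $\Phi(rm)=\phi(r)\Phi(m)$. $K=\mathbb C(\{z\})$ denotes the field of convergent Laurent series (germs at $0$ of meromorphic functions), with $\phi(f)(z)=f(qz)$; $\mathbb C[z,z^{-1}]$ is a difference subring. A difference module $M$ over $K$ is regular singular if there is a $K$-basis $e_1,\dots,e_m$ of $M$ such that the lattice $\mathbb C\{z\}e_1\oplus\cdots\oplus\mathbb C\{z\}e_m$ is mapped onto itself by $\Phi$ and $\Phi^{-1}$ (here $\mathbb C\{z\}$ is the ring of convergent power series). *)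

theory Defs
  imports "HOL-Analysis.Analysis" "HOL-Computational_Algebra.Formal_Laurent_Series"
begin

text \<open>The field K of convergent Laurent series is modelled as the formal Laurent
series (finitely many negative-degree terms) whose regular part has positive
radius of convergence.\<close>

definition fls_convergent :: "complex fls \<Rightarrow> bool" where
  "fls_convergent f \<longleftrightarrow> fps_conv_radius (fls_regpart f) > 0"

text \<open>The difference automorphism phi: f(z) maps to f(qz), i.e. the n-th coefficient
is multiplied by q to the power n.\<close>

lift_definition fls_qdil :: "complex \<Rightarrow> complex fls \<Rightarrow> complex fls"
  is "\<lambda>q f n. q powi n * f n"
  by (auto elim: eventually_mono)

text \<open>Laurent polynomials: the subring C[z,z^-1] (only finitely many nonzero coefficients).\<close>

definition fls_laurent_poly :: "complex fls \<Rightarrow> bool" where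
  "fls_laurent_poly f \<longleftrightarrow> (\<exists>N::int. \<forall>n\<ge>N. fls_nth f n = 0)"

text \<open>The module M = K tensor V with V = C^n: elements are vectors of Laurent series;
Phi(a tensor v) = phi(a) tensor A v, written in coordinates.\<close>

definition dmod_Phi :: "complex \<Rightarrow> complex^'n^'n \<Rightarrow> complex fls^'n \<Rightarrow> complex fls^'n" where
  "dmod_Phi q A m = (\<chi> i. \<Sum>j\<in>UNIV. fls_const (A $ i $ j) * fls_qdil q (m $ j))"

text \<open>Complex scalar multiplication on M and the complex span of a set of elements of M.\<close>

definition cscale :: "complex \<Rightarrow> complex fls^'n \<Rightarrow> complex fls^'n" where
  "cscale c m = (\<chi> i. fls_const c * m $ i)"

definition cspan :: "(complex fls^'n) set \<Rightarrow> (complex fls^'n) set" where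
  "cspan S = {x. \<exists>T c. finite T \<and> T \<subseteq> S \<and> x = (\<Sum>s\<in>T. cscale (c s) s)}"

text \<open>M_global: elements whose forward Phi-orbit spans a finite-dimensional C-space.\<close>

definition M_global :: "complex \<Rightarrow> complex^'n^'n \<Rightarrow> (complex fls^'n) set" where
  "M_global q A = {m. (\<forall>i. fls_convergent (m $ i)) \<and>
     (\<exists>S. finite S \<and> (\<forall>k::nat. (dmod_Phi q A ^^ k) m \<in> cspan S))}"

end

theory Submission
  imports Defs
begin

text \<open>The n-th coefficient vector of Phi^k m is (q^n)^k A^k m_n. If the Phi-orbit of m
spans a finite-dimensional space, there is a nontrivial relation sum_k c_k Phi^k m = 0, hence
sum_k c_k q^(nk) A^k m_n = 0 for every n >= 0. For the least index k1 with c_k1 \<noteq> 0, dividing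
by q^(n k1) leaves the term c_k1 A^k1 m_n against terms of norm O(|q|^n |A^k1 m_n|); so
A^k1 m_n = 0, and m_n = 0 by invertibility, for all large n. Conversely, Phi maps the
finite-dimensional space of vectors supported in a fixed range of degrees into itself.\<close>

lemma norm_scalar_mult_vec: "norm ((c::'a::real_normed_field) *s (x::'a^'n)) = norm c * norm x"
  unfolding norm_vec_def by (simp add: norm_mult L2_set_right_distrib)

lemma matrix_funpow_norm_bound:
  fixes A :: "complex^'n^'n"
  obtains K where "K \<ge> 1" "\<And>j x. norm (((*v) A ^^ j) x) \<le> K ^ j * norm x"
proof -
  obtain K0 where K0: "\<And>x. norm (A *v x) \<le> norm x * K0"
    using bounded_linear.bounded[OF matrix_vector_mul_bounded_linear[of A]] by blast
  define K where "K = max 1 K0"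
  have K1: "K \<ge> 1"
    by (simp add: K_def)
  have step: "norm (A *v x) \<le> K * norm x" for x
  proof -
    have "norm x * K0 \<le> norm x * K"
      by (intro mult_left_mono) (auto simp: K_def)
    with K0[of x] have "norm (A *v x) \<le> norm x * K"
      by (rule order.trans)
    then show ?thesis
      by (simp only: mult.commute)
  qed
  have "norm (((*v) A ^^ j) x) \<le> K ^ j * norm x" for j x
  proof (induction j)
    case (Suc j)
    have "norm (((*v) A ^^ Suc j) x) \<le> K * norm (((*v) A ^^ j) x)"
      using step by simp
    also have "\<dots> \<le> K * (K ^ j * norm x)"
      using Suc.IH K1 by (intro mult_left_mono) auto
    finally show ?case
      by (simp add: mult.assoc)
  qed simp
  with K1 show ?thesis
    by (rule that)
qed

lemma norm_sum_higher_terms_le: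
  fixes B :: "complex^'n^'n"
  assumes q: "norm q \<le> 1" and K: "K \<ge> 1" "\<And>j x. norm (((*v) B ^^ j) x) \<le> K ^ j * norm x"
  shows "norm (\<Sum>j\<in>{..d} - {0}. (mu j * (q ^ n) ^ j) *s ((*v) B ^^ j) x)
    \<le> norm q ^ n * (K ^ d * (\<Sum>j\<le>d. norm (mu j))) * norm x"
proof -
  have "norm (\<Sum>j\<in>{..d} - {0}. (mu j * (q ^ n) ^ j) *s ((*v) B ^^ j) x)
      \<le> (\<Sum>j\<in>{..d} - {0}. norm (mu j) * (norm q ^ n * (K ^ d * norm x)))"
  proof (intro order.trans[OF norm_sum] sum_mono)
    fix j assume j: "j \<in> {..d} - {0}"
    have "norm q ^ (n * j) \<le> norm q ^ n"
      using j q by (intro power_decreasing) auto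
    moreover have "K ^ j * norm x \<le> K ^ d * norm x"
      using j K(1) by (intro mult_right_mono power_increasing) auto
    ultimately have "norm q ^ (n * j) * norm (((*v) B ^^ j) x) \<le> norm q ^ n * (K ^ d * norm x)"
      using K(2)[of j x] by (intro mult_mono) auto
    moreover have "norm ((mu j * (q ^ n) ^ j) *s ((*v) B ^^ j) x)
        = norm (mu j) * (norm q ^ (n * j) * norm (((*v) B ^^ j) x))"
      by (simp add: norm_scalar_mult_vec norm_mult norm_power power_mult)
    ultimately show "norm ((mu j * (q ^ n) ^ j) *s ((*v) B ^^ j) x)
        \<le> norm (mu j) * (norm q ^ n * (K ^ d * norm x))"
      by (metis mult_left_mono norm_ge_zero)
  qed
  also have "\<dots> = (\<Sum>j\<in>{..d} - {0}. norm (mu j)) * (norm q ^ n * (K ^ d * norm x))"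
    by (rule sum_distrib_right[symmetric])
  also have "\<dots> \<le> (\<Sum>j\<le>d. norm (mu j)) * (norm q ^ n * (K ^ d * norm x))"
    using K(1) by (intro mult_right_mono sum_mono2) auto
  finally show ?thesis
    by (simp add: mult_ac)
qed

lemma eventually_zero_of_dominant_constant_term:
  fixes B :: "complex^'n^'n" and w :: "nat \<Rightarrow> complex^'n"
  assumes q: "norm q < 1" and mu0: "mu 0 \<noteq> 0"
    and rel: "\<And>n. (\<Sum>j\<le>d. (mu j * (q ^ n) ^ j) *s ((*v) B ^^ j) (w n)) = 0"
  shows "eventually (\<lambda>n. w n = 0) sequentially"
proof -
  obtain K where K: "K \<ge> 1" "\<And>j x. norm (((*v) B ^^ j) x) \<le> K ^ j * norm x"
    using matrix_funpow_norm_bound[of B] by blast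
  define C where "C = K ^ d * (\<Sum>j\<le>d. norm (mu j))"
  have "(\<lambda>n. norm q ^ n * C) \<longlonglongrightarrow> 0"
    using q by (intro tendsto_mult_left_zero LIMSEQ_power_zero) simp
  then have "eventually (\<lambda>n. norm q ^ n * C < norm (mu 0)) sequentially"
    using mu0 by (intro order_tendstoD(2)) auto
  then show ?thesis
  proof (rule eventually_mono)
    fix n assume small: "norm q ^ n * C < norm (mu 0)"
    let ?t = "\<lambda>j. (mu j * (q ^ n) ^ j) *s ((*v) B ^^ j) (w n)"
    have "mu 0 *s w n = - (\<Sum>j\<in>{..d} - {0}. ?t j)"
      using rel[of n] sum.remove[of "{..d}" 0 ?t] by (simp add: eq_neg_iff_add_eq_0)
    then have "norm (mu 0 *s w n) = norm (\<Sum>j\<in>{..d} - {0}. ?t j)"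
      by simp
    then have "norm (mu 0) * norm (w n) \<le> norm q ^ n * C * norm (w n)"
      using norm_sum_higher_terms_le[where mu = mu and n = n and d = d and x = "w n",
          OF less_imp_le[OF q] K]
      by (simp add: norm_scalar_mult_vec C_def)
    with small have "\<not> 0 < norm (w n)"
      by (auto simp: mult_le_cancel_right)
    then show "w n = 0"
      by simp
  qed
qed

lemma inj_matrix_funpow:
  fixes A :: "'a::field^'n^'n"
  assumes "invertible A"
  shows "inj ((*v) A ^^ k)"
  using assms matrix_left_invertible_injective unfolding invertible_def
  by (intro inj_fn) blast

lemma matrix_funpow_zero: "((*v) (A::'a::semiring_1^'n^'n) ^^ k) 0 = 0"
  by (induction k) simp_all

lemma eventually_zero_of_nontrivial_relation:
  fixes A :: "complex^'n^'n" and v :: "nat \<Rightarrow> complex^'n"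
  assumes A: "invertible A" and q: "q \<noteq> 0" "norm q < 1"
    and nontrivial: "k0 \<le> d" "lam k0 \<noteq> 0"
    and rel: "\<And>n. (\<Sum>k\<le>d. (lam k * (q ^ n) ^ k) *s ((*v) A ^^ k) (v n)) = 0"
  shows "eventually (\<lambda>n. v n = 0) sequentially"
proof -
  define k1 where "k1 = (LEAST k. lam k \<noteq> 0)"
  have lam_k1: "lam k1 \<noteq> 0" and "k1 \<le> d"
    using LeastI[of "\<lambda>k. lam k \<noteq> 0" k0] Least_le[of "\<lambda>k. lam k \<noteq> 0" k0] nontrivial
    by (auto simp: k1_def)
  have below_k1: "lam k = 0" if "k < k1" for k
    using not_less_Least[of k "\<lambda>k. lam k \<noteq> 0"] that by (auto simp: k1_def)
  define w where "w n = ((*v) A ^^ k1) (v n)" for n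
  have "(\<Sum>j\<le>d - k1. (lam (j + k1) * (q ^ n) ^ j) *s ((*v) A ^^ j) (w n)) = 0" for n
  proof -
    let ?t = "\<lambda>k. (lam k * (q ^ n) ^ k) *s ((*v) A ^^ k) (v n)"
    have "(\<Sum>k\<le>d. ?t k) = (\<Sum>k\<in>{0 + k1..(d - k1) + k1}. ?t k)"
      using \<open>k1 \<le> d\<close> below_k1 by (intro sum.mono_neutral_right) auto
    also have "\<dots> = (\<Sum>j\<le>d - k1. ?t (j + k1))"
      by (simp only: sum.shift_bounds_cl_nat_ivl atLeast0AtMost)
    also have "\<dots> = (q ^ n) ^ k1 *s (\<Sum>j\<le>d - k1. (lam (j + k1) * (q ^ n) ^ j) *s ((*v) A ^^ j) (w n))"
      by (simp add: w_def vector_smult_assoc power_add funpow_add mult_ac flip: sum_cmul)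
    finally show ?thesis
      using rel[of n] q by simp
  qed
  then have "eventually (\<lambda>n. w n = 0) sequentially"
    using q lam_k1
    by (intro eventually_zero_of_dominant_constant_term[where mu = "\<lambda>j. lam (j + k1)" and d = "d - k1"])
      auto
  then show ?thesis
    using inj_matrix_funpow[OF A, of k1] by (elim eventually_mono) (metis injD matrix_funpow_zero w_def)
qed

lemma (in vector_space) linear_relation_of_sequence_in_span:
  assumes S: "finite S" and x: "\<And>k. k \<le> card S \<Longrightarrow> x k \<in> span S"
  shows "\<exists>c::nat \<Rightarrow> 'a. \<exists>k0\<le>card S. c k0 \<noteq> 0 \<and> (\<Sum>k\<le>card S. scale (c k) (x k)) = 0"
proof (cases "inj_on x {..card S}")
  case True
  have "x ` {..card S} \<subseteq> span S"
    using x by auto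
  moreover have "card (x ` {..card S}) > card S"
    using True by (simp add: card_image)
  ultimately have "dependent (x ` {..card S})"
    using independent_span_bound[OF S] by fastforce
  then obtain u where u: "\<exists>v\<in>x ` {..card S}. u v \<noteq> 0" "(\<Sum>v\<in>x ` {..card S}. scale (u v) v) = 0"
    by (auto simp: dependent_finite)
  have "(\<Sum>k\<le>card S. scale (u (x k)) (x k)) = 0"
    using u(2) by (simp add: sum.reindex[OF True])
  with u(1) show ?thesis
    by (intro exI[of _ "u \<circ> x"]) auto
next
  case False
  then obtain i j where ij: "i \<le> card S" "j \<le> card S" "i \<noteq> j" "x i = x j"
    unfolding inj_on_def by auto
  define c :: "nat \<Rightarrow> 'a" where "c k = (if k = i then 1 else if k = j then -1 else 0)" for k
  have "(\<Sum>k\<le>card S. scale (c k) (x k)) = (\<Sum>k\<le>card S. (if k = i then x i else 0) - (if k = j then x j else 0))"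
    using ij(3) by (intro sum.cong) (auto simp: c_def)
  also have "\<dots> = 0"
    using ij by (simp add: sum_subtractf)
  finally show ?thesis
    using ij(1) by (intro exI[of _ c] exI[of _ i]) (simp add: c_def)
qed

interpretation cscale: vector_space "cscale :: complex \<Rightarrow> complex fls^'n \<Rightarrow> complex fls^'n"
  by unfold_locales
    (auto simp: cscale_def vec_eq_iff distrib_left distrib_right mult.assoc
      simp flip: fls_plus_const fls_const_mult_const)

lemma cspan_eq_span: "cspan S = cscale.span S"
  unfolding cspan_def cscale.span_explicit by blast

definition fls_vec_nth :: "'a::zero fls^'n \<Rightarrow> int \<Rightarrow> 'a^'n" where
  "fls_vec_nth m n = (\<chi> j. fls_nth (m $ j) n)"

lemma fls_vec_nth_sum: "fls_vec_nth (\<Sum>x\<in>X. f x) n = (\<Sum>x\<in>X. fls_vec_nth (f x) n)"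
  by (simp add: fls_vec_nth_def vec_eq_iff fls_nth_sum)

lemma fls_vec_nth_cscale: "fls_vec_nth (cscale c m) n = c *s fls_vec_nth m n"
  by (simp add: fls_vec_nth_def cscale_def vec_eq_iff)

lemma fls_vec_nth_dmod_Phi: "fls_vec_nth (dmod_Phi q A m) n = (q powi n) *s (A *v fls_vec_nth m n)"
  by (simp add: fls_vec_nth_def dmod_Phi_def vec_eq_iff matrix_vector_mult_def fls_nth_sum
      fls_qdil.rep_eq sum_distrib_left mult_ac)

lemma fls_vec_nth_dmod_Phi_funpow:
  "fls_vec_nth ((dmod_Phi q A ^^ k) m) n = (q powi n) ^ k *s ((*v) A ^^ k) (fls_vec_nth m n)"
  by (induction k)
    (simp_all add: fls_vec_nth_dmod_Phi vector_scalar_commute vector_smult_assoc mult_ac)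

lemma fls_laurent_poly_convergent:
  assumes "fls_laurent_poly f"
  shows "fls_convergent f"
proof -
  obtain N where N: "\<And>n. n \<ge> N \<Longrightarrow> fls_nth f n = 0"
    using assms unfolding fls_laurent_poly_def by blast
  have "eventually (\<lambda>n. fps_nth (fls_regpart f) n = 0) sequentially"
    unfolding eventually_sequentially by (intro exI[of _ "nat N"]) (auto intro!: N)
  then have "conv_radius (fps_nth (fls_regpart f)) = conv_radius (\<lambda>_. 0::complex)"
    by (rule conv_radius_cong')
  then show ?thesis
    by (simp add: fls_convergent_def fps_conv_radius_def)
qed

lemma laurent_poly_components_iff:
  fixes m :: "complex fls^'n"
  shows "(\<forall>i. fls_laurent_poly (m $ i)) \<longleftrightarrow> (\<exists>N. \<forall>n\<ge>N. fls_vec_nth m n = 0)"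
proof
  assume "\<forall>i. fls_laurent_poly (m $ i)"
  then obtain N where N: "\<And>i n. n \<ge> N i \<Longrightarrow> fls_nth (m $ i) n = 0"
    unfolding fls_laurent_poly_def by metis
  have "fls_vec_nth m n = 0" if "n \<ge> Max (range N)" for n
  proof -
    have "N i \<le> n" for i
      using that Max_ge[of "range N" "N i"] by auto
    then show ?thesis
      using N by (simp add: fls_vec_nth_def vec_eq_iff)
  qed
  then show "\<exists>N. \<forall>n\<ge>N. fls_vec_nth m n = 0"
    by blast
qed (auto simp: fls_laurent_poly_def fls_vec_nth_def vec_eq_iff)

lemma fls_vec_nth_eq_0_below:
  fixes m :: "'a::zero fls^'n"
  shows "\<exists>L. \<forall>n<L. fls_vec_nth m n = 0"
proof -
  have "fls_vec_nth m n = 0" if "n < Min (range (\<lambda>i. fls_subdegree (m $ i)))" for n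
    using that by (auto simp: fls_vec_nth_def vec_eq_iff intro!: nth_less_subdegree_zero
        dest!: order.strict_trans2[OF _ Min_le, rotated])
  then show ?thesis
    by blast
qed

definition monomial_vec :: "'n \<Rightarrow> int \<Rightarrow> complex fls^'n" where
  "monomial_vec j n = (\<chi> i. if i = j then fls_X_intpow n else 0)"

lemma in_cspan_monomial_vecs:
  fixes m :: "complex fls^'n"
  assumes "\<And>n. n \<notin> {L..<N} \<Longrightarrow> fls_vec_nth m n = 0"
  shows "m \<in> cspan ((\<lambda>(j, n). monomial_vec j n) ` (UNIV \<times> {L..<N}))"
proof -
  have "m = (\<Sum>j\<in>UNIV. \<Sum>n\<in>{L..<N}. cscale (fls_nth (m $ j) n) (monomial_vec j n))"
    (is "_ = ?sum")
  proof (subst vec_eq_iff, intro allI fls_eqI)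
    fix i t
    have "fls_nth (?sum $ i) t
        = (\<Sum>j\<in>UNIV. \<Sum>n\<in>{L..<N}. if i = j \<and> t = n then fls_nth (m $ j) n else 0)"
      unfolding sum_component fls_nth_sum
      by (intro sum.cong refl) (auto simp: cscale_def monomial_vec_def)
    also have "\<dots> = (\<Sum>j\<in>UNIV. if j = i
        then (\<Sum>n\<in>{L..<N}. if t = n then fls_nth (m $ i) n else 0) else 0)"
      by (intro sum.cong refl) auto
    also have "\<dots> = (if t \<in> {L..<N} then fls_nth (m $ i) t else 0)"
      by (simp add: sum.delta')
    also have "\<dots> = fls_nth (m $ i) t"
      using assms[of t] by (auto simp: fls_vec_nth_def vec_eq_iff)
    finally show "fls_nth (m $ i) t = fls_nth (?sum $ i) t"
      by simp
  qed
  also have "\<dots> \<in> cscale.span ((\<lambda>(j, n). monomial_vec j n) ` (UNIV \<times> {L..<N}))"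
    by (intro cscale.span_sum cscale.span_scale cscale.span_base) auto
  finally show ?thesis
    by (simp add: cspan_eq_span)
qed

lemma laurent_poly_vec_in_M_global:
  fixes m :: "complex fls^'n"
  assumes "\<forall>i. fls_laurent_poly (m $ i)"
  shows "m \<in> M_global q A"
proof -
  obtain N where N: "\<forall>n\<ge>N. fls_vec_nth m n = 0"
    using assms laurent_poly_components_iff by blast
  obtain L where L: "\<forall>n<L. fls_vec_nth m n = 0"
    using fls_vec_nth_eq_0_below by blast
  define B :: "(complex fls^'n) set" where "B = (\<lambda>(j, n). monomial_vec j n) ` (UNIV \<times> {L..<N})"
  have "finite B"
    by (simp add: B_def)
  moreover have "(dmod_Phi q A ^^ k) m \<in> cspan B" for k
    unfolding B_def
  proof (rule in_cspan_monomial_vecs)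
    fix n assume "n \<notin> {L..<N}"
    then have "fls_vec_nth m n = 0"
      using L N by auto
    then show "fls_vec_nth ((dmod_Phi q A ^^ k) m) n = 0"
      by (simp add: fls_vec_nth_dmod_Phi_funpow matrix_funpow_zero)
  qed
  ultimately show ?thesis
    using assms fls_laurent_poly_convergent unfolding M_global_def by blast
qed

lemma laurent_poly_of_M_global:
  fixes m :: "complex fls^'n"
  assumes A: "invertible A" and q: "q \<noteq> 0" "norm q < 1" and m: "m \<in> M_global q A"
  shows "fls_laurent_poly (m $ i)"
proof -
  obtain S where S: "finite S" "\<And>k. (dmod_Phi q A ^^ k) m \<in> cscale.span S"
    using m unfolding M_global_def cspan_eq_span by blast
  then obtain c k0 where k0: "k0 \<le> card S" "c k0 \<noteq> 0"
    and rel: "(\<Sum>k\<le>card S. cscale (c k) ((dmod_Phi q A ^^ k) m)) = 0"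
    using cscale.linear_relation_of_sequence_in_span[OF S(1), of "\<lambda>k. (dmod_Phi q A ^^ k) m"] S(2)
    by blast
  have "(\<Sum>k\<le>card S. (c k * (q ^ n) ^ k) *s ((*v) A ^^ k) (fls_vec_nth m (int n))) = 0" for n
  proof -
    have "fls_vec_nth (\<Sum>k\<le>card S. cscale (c k) ((dmod_Phi q A ^^ k) m)) (int n) = 0"
      by (simp add: rel fls_vec_nth_def vec_eq_iff)
    then show ?thesis
      by (simp add: fls_vec_nth_sum fls_vec_nth_cscale fls_vec_nth_dmod_Phi_funpow vector_smult_assoc)
  qed
  then have "eventually (\<lambda>n. fls_vec_nth m (int n) = 0) sequentially"
    by (rule eventually_zero_of_nontrivial_relation[where lam = c and d = "card S", OF A q k0])
  then obtain N where N: "\<And>n. n \<ge> N \<Longrightarrow> fls_vec_nth m (int n) = 0"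
    unfolding eventually_sequentially by blast
  have "fls_vec_nth m n = 0" if "n \<ge> int N" for n
    using N[of "nat n"] that by simp
  then show ?thesis
    using laurent_poly_components_iff by blast
qed

lemma vec_sum_unit_component:
  "(\<Sum>j\<in>UNIV. (\<chi> i. c j * (if i = j then 1 else 0))) $ i = (c i :: 'a::semiring_1)"
proof -
  have "(\<Sum>j\<in>UNIV. (\<chi> i. c j * (if i = j then 1 else 0))) $ i = (\<Sum>j\<in>UNIV. if j = i then c j else 0)"
    unfolding sum_component by (intro sum.cong) auto
  then show ?thesis
    by simp
qed

lemma ex1_unit_vec_coordinates:
  fixes m :: "'a::semiring_1^'n"
  assumes "\<forall>i. P (m $ i)"
  shows "\<exists>!c. (\<forall>j. P (c j)) \<and> m = (\<Sum>j\<in>UNIV. (\<chi> i. c j * (if i = j then 1 else 0)))"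
proof (rule ex1I[of _ "\<lambda>j. m $ j"])
  show "(\<forall>j. P (m $ j)) \<and> m = (\<Sum>j\<in>UNIV. (\<chi> i. m $ j * (if i = j then 1 else 0)))"
    using assms by (simp add: vec_eq_iff vec_sum_unit_component del: sum_component)
next
  fix c assume "(\<forall>j. P (c j)) \<and> m = (\<Sum>j\<in>UNIV. (\<chi> i. c j * (if i = j then 1 else 0)))"
  then show "c = (\<lambda>j. m $ j)"
    by (simp add: vec_sum_unit_component del: sum_component)
qed

theorem lemma1p1:
  fixes q :: complex and A :: "complex^'n^'n"
  assumes "0 < norm q" "norm q < 1"
    and "invertible A"
    and "\<And>\<alpha> v. v \<noteq> 0 \<Longrightarrow> A *v v = \<alpha> *s v \<Longrightarrow> norm q < norm \<alpha> \<and> norm \<alpha> \<le> 1"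
  shows "M_global q A = {m. \<forall>i. fls_laurent_poly (m $ i)}
    \<and> (\<forall>j. (\<chi> i. if i = j then 1 else 0) \<in> M_global q A)
    \<and> (\<forall>m::complex fls^'n. (\<forall>i. fls_convergent (m $ i)) \<longrightarrow>
          (\<exists>!c. (\<forall>j. fls_convergent (c j)) \<and>
               m = (\<Sum>j\<in>UNIV. (\<chi> i. c j * (if i = j then 1 else 0)))))"
proof (intro conjI allI impI)
  have "q \<noteq> 0"
    using assms(1) by auto
  then show M_global_eq: "M_global q A = {m. \<forall>i. fls_laurent_poly (m $ i)}"
    using laurent_poly_of_M_global[OF assms(3)] assms(2) laurent_poly_vec_in_M_global by blast
  show "(\<chi> i. if i = j then 1 else 0) \<in> M_global q A" for j
    unfolding M_global_eq fls_laurent_poly_def by (auto intro: exI[of _ 1])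
  show "\<exists>!c. (\<forall>j. fls_convergent (c j)) \<and> m = (\<Sum>j\<in>UNIV. (\<chi> i. c j * (if i = j then 1 else 0)))"
    if "\<forall>i. fls_convergent (m $ i)" for m :: "complex fls^'n"
    using that by (rule ex1_unit_vec_coordinates)
qed

end
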